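(* Let $(X,d)$, $|X|\geqslant3$, be a complete semimetric space with a triangle function $\Phi$ that is continuous at $(0,0)$ and satisfies the following conditions: 1) $\Phi(ku,kv)=k\Phi(u,v)$ for all $k,u,v\in[0,\infty)$; 2) for every $0\leqslant a<1$ there exists $C(a)>0$ such that for every positive integer $p$ one has $\Phi(1,\Phi(a,\Phi(a^2,\ldots,\Phi(a^{p-1},a^{p}))))\leqslant C(a)$. Let the mapping $T\colon X\to X$ satisfy the following two conditions: (i) $T$ does not possess periodic points of prime period $2$, i.e., there is no $x\in X$ with $T(T(x))=x$ and $Tx\neq x$; (ii) $T$ is a mapping contracting perimeters of triangles on $X$. Then $T$ has a fixed point, and the number of fixed points of $T$ is at most two.
   Context: Let $X$ be a nonempty set. A semimetric on $X$ is a map $d\colon X\times X\to[0,\infty)$ such that $d(x,y)=0$ if and only if $x=y$, and $d(x,y)=d(y,x)$ for all $x,y\in X$ (no triangle inequality is required). The pair $(X,d)$ is then called a semimetric space. A function $\Phi\colon[0,\infty)\times[0,\infty)\to[0,\infty)$ is a triangle function for $d$ if $\Phi$ is symmetric, nondecreasing in each of its arguments, $\Phi(0,0)=0$, and $d(x,y)\leqslant\Phi(d(x,z),d(z,y))$ for all $x,y,z\in X$. For a semimetric space $(X,d)$ with $|X|\geqslant3$, a map $T\colon X\to X$ is a mapping contracting perimeters of triangles on $X$ if there exists $\alpha\in[0,1)$ such that $$d(Tx,Ty)+d(Ty,Tz)+d(Tx,Tz)\leqslant\alpha\,(d(x,y)+d(y,z)+d(x,z))$$ for all three pairwise distinct points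 $x,y,z\in X$. Convergence, Cauchy sequences and completeness are defined as usual: $x_n\to x$ means $d(x_n,x)\to0$; $(x_n)$ is Cauchy if for every $\varepsilon>0$ there is $N$ with $d(x_n,x_m)<\varepsilon$ for all $n,m\geqslant N$; $(X,d)$ is complete if every Cauchy sequence converges to a point of $X$. For $p=1$ the nested expression in condition 2) is $\Phi(1,a)$, for $p=2$ it is $\Phi(1,\Phi(a,a^2))$, and so on (with $a^0=1$). *)

theory Defs
  imports "HOL-Analysis.Analysis"
begin

definition semimetric_space :: "'a set \<Rightarrow> ('a \<Rightarrow> 'a \<Rightarrow> real) \<Rightarrow> bool" where
  "semimetric_space X d \<longleftrightarrow>
     X \<noteq> {} \<and>
     (\<forall>x\<in>X. \<forall>y\<in>X. 0 \<le> d x y) \<and>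
     (\<forall>x\<in>X. \<forall>y\<in>X. d x y = 0 \<longleftrightarrow> x = y) \<and>
     (\<forall>x\<in>X. \<forall>y\<in>X. d x y = d y x)"

text \<open>Functions on \<open>[0,\<infinity>) \<times> [0,\<infinity>)\<close> are total functions on the reals
  that are only ever constrained at nonnegative arguments.\<close>

definition triangle_function :: "'a set \<Rightarrow> ('a \<Rightarrow> 'a \<Rightarrow> real) \<Rightarrow> (real \<Rightarrow> real \<Rightarrow> real) \<Rightarrow> bool" where
  "triangle_function X d \<Phi> \<longleftrightarrow>
     (\<forall>u\<ge>0. \<forall>v\<ge>0. 0 \<le> \<Phi> u v) \<and>
     (\<forall>u\<ge>0. \<forall>v\<ge>0. \<Phi> u v = \<Phi> v u) \<and>
     (\<forall>v\<ge>0. mono_on {0..} (\<lambda>u. \<Phi> u v)) \<and>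
     (\<forall>u\<ge>0. mono_on {0..} (\<lambda>v. \<Phi> u v)) \<and>
     \<Phi> 0 0 = 0 \<and>
     (\<forall>x\<in>X. \<forall>y\<in>X. \<forall>z\<in>X. d x y \<le> \<Phi> (d x z) (d z y))"

definition semimetric_converges :: "('a \<Rightarrow> 'a \<Rightarrow> real) \<Rightarrow> (nat \<Rightarrow> 'a) \<Rightarrow> 'a \<Rightarrow> bool" where
  "semimetric_converges d s x \<longleftrightarrow> (\<lambda>n. d (s n) x) \<longlonglongrightarrow> 0"

definition semimetric_Cauchy :: "('a \<Rightarrow> 'a \<Rightarrow> real) \<Rightarrow> (nat \<Rightarrow> 'a) \<Rightarrow> bool" where
  "semimetric_Cauchy d s \<longleftrightarrow> (\<forall>\<epsilon>>0. \<exists>N. \<forall>n\<ge>N. \<forall>m\<ge>N. d (s n) (s m) < \<epsilon>)"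

definition semimetric_complete :: "'a set \<Rightarrow> ('a \<Rightarrow> 'a \<Rightarrow> real) \<Rightarrow> bool" where
  "semimetric_complete X d \<longleftrightarrow>
     (\<forall>s. range s \<subseteq> X \<and> semimetric_Cauchy d s \<longrightarrow> (\<exists>x\<in>X. semimetric_converges d s x))"

definition contracts_triangle_perimeters ::
    "'a set \<Rightarrow> ('a \<Rightarrow> 'a \<Rightarrow> real) \<Rightarrow> ('a \<Rightarrow> 'a) \<Rightarrow> bool" where
  "contracts_triangle_perimeters X d T \<longleftrightarrow>
     (\<exists>\<alpha>. 0 \<le> \<alpha> \<and> \<alpha> < 1 \<and>
       (\<forall>x\<in>X. \<forall>y\<in>X. \<forall>z\<in>X. x \<noteq> y \<and> y \<noteq> z \<and> x \<noteq> z \<longrightarrow>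
          d (T x) (T y) + d (T y) (T z) + d (T x) (T z) \<le> \<alpha> * (d x y + d y z + d x z)))"

text \<open>\<open>nested_powers \<Phi> a k m\<close> is
  \<open>\<Phi> (a^k) (\<Phi> (a^(k+1)) (\<dots> (\<Phi> (a^(k+m-1)) (a^(k+m)))))\<close>, with \<open>m\<close> occurrences of \<open>\<Phi>\<close>.\<close>

primrec nested_powers :: "(real \<Rightarrow> real \<Rightarrow> real) \<Rightarrow> real \<Rightarrow> nat \<Rightarrow> nat \<Rightarrow> real" where
  "nested_powers \<Phi> a k 0 = a ^ k"
| "nested_powers \<Phi> a k (Suc m) = \<Phi> (a ^ k) (nested_powers \<Phi> a (Suc k) m)"

end

theory Submission
  imports Defs
begin

text \<open>If \<open>T\<close> had no fixed point, any three consecutive points of an orbit \<open>x\<^sub>n\<close> would be pairwise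
  distinct (there are no points of period 2), so the perimeters of these triangles would decay
  like \<open>\<alpha>\<^sup>n\<close>. By homogeneity of \<open>\<Phi>\<close> the nested triangle inequality bounds
  \<open>d (x\<^sub>n, x\<^sub>m)\<close> for \<open>m > n\<close> by a constant times \<open>\<alpha>\<^sup>n\<close>, so the orbit converges to
  some \<open>l\<close>; contraction of the triangles \<open>x\<^sub>n, x\<^sub>n\<^sub>+\<^sub>1, l\<close> then gives convergence of the orbit to
  \<open>T l\<close> as well. Limits are unique because \<open>\<Phi>(u, v) \<le> (u + v) \<Phi>(1, 1)\<close>. Three distinct fixed
  points would form a triangle of positive perimeter that \<open>T\<close> does not contract.\<close>

locale homogeneous_semimetric =
  fixes X :: "'a set" and d :: "'a \<Rightarrow> 'a \<Rightarrow> real" and \<Phi> :: "real \<Rightarrow> real \<Rightarrow> real"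
  assumes semimetric: "semimetric_space X d"
    and triangle_fun: "triangle_function X d \<Phi>"
    and homogeneous: "\<lbrakk>k \<ge> 0; u \<ge> 0; v \<ge> 0\<rbrakk> \<Longrightarrow> \<Phi> (k * u) (k * v) = k * \<Phi> u v"
begin

lemma
  assumes "x \<in> X" "y \<in> X"
  shows nonneg: "0 \<le> d x y"
    and zero_iff: "d x y = 0 \<longleftrightarrow> x = y"
    and commute: "d x y = d y x"
  using semimetric assms unfolding semimetric_space_def by simp_all

lemma positive: "\<lbrakk>x \<in> X; y \<in> X; x \<noteq> y\<rbrakk> \<Longrightarrow> 0 < d x y"
  using nonneg[of x y] zero_iff[of x y] by simp

lemma triangle: "\<lbrakk>x \<in> X; y \<in> X; z \<in> X\<rbrakk> \<Longrightarrow> d x y \<le> \<Phi> (d x z) (d z y)"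
  and Phi_nonneg: "\<lbrakk>0 \<le> u; 0 \<le> v\<rbrakk> \<Longrightarrow> 0 \<le> \<Phi> u v"
  using triangle_fun unfolding triangle_function_def by blast+

lemma Phi_mono:
  assumes "0 \<le> u" "u \<le> u'" "0 \<le> v" "v \<le> v'"
  shows "\<Phi> u v \<le> \<Phi> u' v'"
proof -
  have "\<Phi> u v \<le> \<Phi> u' v"
    using triangle_fun assms unfolding triangle_function_def mono_on_def by auto
  also have "\<Phi> u' v \<le> \<Phi> u' v'"
    using triangle_fun assms unfolding triangle_function_def mono_on_def by auto
  finally show ?thesis .
qed

text \<open>Both arguments are at most \<open>u + v\<close>, and homogeneity takes this factor out
  of \<open>\<Phi> (u + v) (u + v)\<close>. With the triangle inequality this makes \<open>d\<close>
  satisfy a b-metric inequality with constant \<open>\<Phi> 1 1\<close>.\<close>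

lemma Phi_le_sum:
  assumes "0 \<le> u" "0 \<le> v"
  shows "\<Phi> u v \<le> (u + v) * \<Phi> 1 1"
  using Phi_mono[of u "u + v" v "u + v"] homogeneous[of "u + v" 1 1] assms by simp

lemma limit_unique:
  assumes "range s \<subseteq> X" "x \<in> X" "y \<in> X"
    and "semimetric_converges d s x" "semimetric_converges d s y"
  shows "x = y"
proof -
  have le: "d x y \<le> (d (s n) x + d (s n) y) * \<Phi> 1 1" for n
  proof -
    have "s n \<in> X" using assms(1) by blast
    then show ?thesis
      using triangle[of x y "s n"] Phi_le_sum[of "d x (s n)" "d (s n) y"]
        commute[of x "s n"] nonneg[of "s n" x] nonneg[of "s n" y] assms(2,3) by simp
  qed
  have "(\<lambda>n. (d (s n) x + d (s n) y) * \<Phi> 1 1) \<longlonglongrightarrow> (0 + 0) * \<Phi> 1 1"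
    using assms(4,5) unfolding semimetric_converges_def by (intro tendsto_intros)
  then have "d x y \<le> 0"
    using le by (intro LIMSEQ_le_const) auto
  then show ?thesis
    using nonneg[of x y] zero_iff[of x y] assms(2,3) by simp
qed

lemma nested_powers_nonneg: "0 \<le> a \<Longrightarrow> 0 \<le> nested_powers \<Phi> a k m"
  by (induction m arbitrary: k) (auto intro: Phi_nonneg)

text \<open>Homogeneity moves the common factor \<open>a ^ j\<close> out through every level of
  nesting. A nested expression that starts at \<open>a ^ n\<close> thus reduces to one that starts
  at 1, for which a uniform bound is available.\<close>

lemma nested_powers_shift:
  assumes "0 \<le> a"
  shows "nested_powers \<Phi> a (k + j) m = a ^ j * nested_powers \<Phi> a k m"
proof (induction m arbitrary: k)
  case (Suc m)
  then show ?case
    using homogeneous[of "a ^ j" "a ^ k" "nested_powers \<Phi> a (Suc k) m"]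
      nested_powers_nonneg[of a "Suc k" m] assms Suc[of "Suc k"]
    by (simp add: power_add mult.commute)
qed (simp add: power_add mult.commute)

text \<open>The triangle inequality at \<open>s (Suc k)\<close> splits off the first step,
  monotonicity inserts the bounds for both parts, and homogeneity extracts \<open>P\<close>. Since
  \<open>m\<close> occurrences of \<open>\<Phi>\<close> join \<open>m + 1\<close> steps, the
  endpoint has index \<open>Suc (k + m)\<close>.\<close>

lemma dist_le_nested_powers:
  assumes "range s \<subseteq> X" "0 \<le> a" "0 \<le> P"
    and step: "\<And>n. d (s n) (s (Suc n)) \<le> P * a ^ n"
  shows "d (s k) (s (Suc (k + m))) \<le> P * nested_powers \<Phi> a k m"
proof (induction m arbitrary: k)
  case 0
  then show ?case using step by simp
next
  case (Suc m)
  have X: "s n \<in> X" for n using assms(1) by blast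
  have "d (s k) (s (Suc (k + Suc m)))
      \<le> \<Phi> (d (s k) (s (Suc k))) (d (s (Suc k)) (s (Suc (k + Suc m))))"
    by (intro triangle X)
  also have "\<dots> \<le> \<Phi> (P * a ^ k) (P * nested_powers \<Phi> a (Suc k) m)"
    using Suc[of "Suc k"] step by (intro Phi_mono nonneg X) simp_all
  also have "\<dots> = P * nested_powers \<Phi> a k (Suc m)"
    using assms(2,3) by (simp add: homogeneous nested_powers_nonneg)
  finally show ?case .
qed

lemma Cauchy_if_geometric_steps:
  assumes X: "range s \<subseteq> X" and a: "0 \<le> a" "a < 1" and P: "0 \<le> P"
    and step: "\<And>n. d (s n) (s (Suc n)) \<le> P * a ^ n"
    and bound: "\<And>m. nested_powers \<Phi> a 0 m \<le> C"
  shows "semimetric_Cauchy d s"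
  unfolding semimetric_Cauchy_def
proof (intro allI impI)
  fix \<epsilon> :: real assume \<epsilon>: "\<epsilon> > 0"
  have sX: "s n \<in> X" for n using X by blast
  \<comment> \<open>The nested expression with no \<open>\<Phi>\<close> is \<open>a ^ 0 = 1\<close>,
    so even \<open>1 \<le> C\<close> holds.\<close>
  have C: "0 \<le> C" using bound[of 0] by simp
  \<comment> \<open>The bound decays in the smaller index and is uniform in the larger one; this is
    where the bound \<open>C\<close>, independent of the depth of nesting, enters.\<close>
  have tail: "d (s n) (s m) \<le> P * C * a ^ n" if "n \<le> m" for n m
  proof (cases "n = m")
    case True
    then show ?thesis using zero_iff[OF sX sX, of n n] a(1) P C by simp
  next
    case False
    then have "n < m" using that by simp
    then obtain k where k: "m = Suc (n + k)"
      using less_imp_Suc_add by blast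
    have "d (s n) (s m) \<le> P * (a ^ n * nested_powers \<Phi> a 0 k)"
      using dist_le_nested_powers[OF X a(1) P step, of n k]
        nested_powers_shift[OF a(1), of 0 n k] k by simp
    also have "\<dots> \<le> P * (a ^ n * C)"
      using bound a(1) P by (intro mult_left_mono) auto
    finally show ?thesis by (simp add: mult_ac)
  qed
  have "(\<lambda>n. P * C * a ^ n) \<longlonglongrightarrow> P * C * 0"
    using a by (intro tendsto_intros LIMSEQ_realpow_zero)
  then have "\<forall>\<^sub>F n in sequentially. P * C * a ^ n < \<epsilon>"
    using \<epsilon> by (intro order_tendstoD) auto
  then obtain N where N: "\<And>n. n \<ge> N \<Longrightarrow> P * C * a ^ n < \<epsilon>"
    unfolding eventually_sequentially by blast
  have "d (s n) (s m) < \<epsilon>" if "n \<ge> N" "m \<ge> N" for n m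
  proof (cases "n \<le> m")
    case True
    then show ?thesis using tail N that by (meson le_less_trans)
  next
    case False
    then show ?thesis
      using tail[of m n] N[of m] that commute[OF sX sX, of n m] by simp
  qed
  then show "\<exists>N. \<forall>n\<ge>N. \<forall>m\<ge>N. d (s n) (s m) < \<epsilon>" by blast
qed

lemma fixed_points_le_two:
  assumes "\<alpha> < 1" and contr: "\<And>x y z. \<lbrakk>x \<in> X; y \<in> X; z \<in> X; x \<noteq> y; y \<noteq> z; x \<noteq> z\<rbrakk> \<Longrightarrow>
      d (T x) (T y) + d (T y) (T z) + d (T x) (T z) \<le> \<alpha> * (d x y + d y z + d x z)"
  shows "finite {x \<in> X. T x = x} \<and> card {x \<in> X. T x = x} \<le> 2"
proof (rule ccontr)
  assume "\<not> ?thesis"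
  \<comment> \<open>The infinite case stands apart because \<open>card\<close> is 0 there. Either
    case yields exactly three fixed points.\<close>
  then consider "infinite {x \<in> X. T x = x}" | "3 \<le> card {x \<in> X. T x = x}" by linarith
  then obtain B where "B \<subseteq> {x \<in> X. T x = x}" "card B = 3"
  proof cases
    case 1
    then show ?thesis using infinite_arbitrarily_large[of _ 3] that by blast
  next
    case 2
    then show ?thesis using obtain_subset_with_card_n that by blast
  qed
  then obtain x y z where xyz: "x \<in> X" "y \<in> X" "z \<in> X" "T x = x" "T y = y" "T z = z"
      "x \<noteq> y" "y \<noteq> z" "x \<noteq> z"
    unfolding card_3_iff by auto
  let ?S = "d x y + d y z + d x z"
  have "0 < ?S" using positive xyz by (simp add: add_pos_pos)
  moreover have "?S \<le> \<alpha> * ?S" using contr[of x y z] xyz by simp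
  ultimately show False using \<open>\<alpha> < 1\<close> by (simp add: mult_le_cancel_right2)
qed

lemma fixed_point_exists:
  assumes complete: "semimetric_complete X d"
    and nested_bound: "\<forall>m\<ge>1. nested_powers \<Phi> \<alpha> 0 m \<le> C"
    and T: "T \<in> X \<rightarrow> X"
    and no_period_two: "\<not> (\<exists>x\<in>X. T (T x) = x \<and> T x \<noteq> x)"
    and \<alpha>: "0 \<le> \<alpha>" "\<alpha> < 1" and contr: "\<And>x y z. \<lbrakk>x \<in> X; y \<in> X; z \<in> X; x \<noteq> y; y \<noteq> z; x \<noteq> z\<rbrakk> \<Longrightarrow>
      d (T x) (T y) + d (T y) (T z) + d (T x) (T z) \<le> \<alpha> * (d x y + d y z + d x z)"
  shows "\<exists>x\<in>X. T x = x"
proof (rule ccontr)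
  assume "\<not> ?thesis"
  then have no_fix: "T x \<noteq> x" if "x \<in> X" for x using that by blast
  obtain x\<^sub>0 where x0: "x\<^sub>0 \<in> X" using semimetric by (auto simp: semimetric_space_def)
  define s where "s n = (T ^^ n) x\<^sub>0" for n
  have s_Suc: "T (s n) = s (Suc n)" for n by (simp add: s_def)
  have sX: "s n \<in> X" for n
    unfolding s_def using x0 T by (induction n) auto
  have ne1: "s n \<noteq> s (Suc n)" for n using no_fix[OF sX, of n] s_Suc by metis
  \<comment> \<open>Equality would give \<open>T (T (s n)) = s n\<close> with
    \<open>T (s n) \<noteq> s n\<close>, a point of prime period 2.\<close>
  have ne2: "s n \<noteq> s (Suc (Suc n))" for n using no_period_two no_fix sX s_Suc by metis
  define p where "p n = d (s n) (s (Suc n)) + d (s (Suc n)) (s (Suc (Suc n)))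
      + d (s n) (s (Suc (Suc n)))" for n
  have p_geometric: "p n \<le> p 0 * \<alpha> ^ n" for n
  proof (induction n)
    case (Suc n)
    \<comment> \<open>The image of the \<open>n\<close>-th orbit triangle is the next one.\<close>
    have "p (Suc n) \<le> \<alpha> * p n"
      unfolding p_def using contr[OF sX sX sX ne1 ne1 ne2, of n] by (simp add: s_Suc)
    also have "\<dots> \<le> \<alpha> * (p 0 * \<alpha> ^ n)" using Suc \<alpha> by (intro mult_left_mono)
    finally show ?case by (simp add: mult_ac)
  qed simp
  have step: "d (s n) (s (Suc n)) \<le> p 0 * \<alpha> ^ n" for n
    using p_geometric[of n] nonneg[OF sX sX] unfolding p_def by (smt (verit))
  have p0: "0 \<le> p 0" using nonneg sX unfolding p_def by simp
  \<comment> \<open>The hypothesis starts at \<open>m = 1\<close>; for \<open>m = 0\<close> the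
    expression equals 1, hence the maximum.\<close>
  have bound: "nested_powers \<Phi> \<alpha> 0 m \<le> max 1 C" for m
    using nested_bound by (cases m) (auto simp: le_max_iff_disj simp del: nested_powers.simps(2))
  have range: "range s \<subseteq> X" using sX by blast
  obtain l where l: "l \<in> X" and conv: "semimetric_converges d s l"
    using complete Cauchy_if_geometric_steps[OF range \<alpha> p0 step bound] range
    unfolding semimetric_complete_def by blast
  have Tl: "T l \<in> X" using T l by blast
  \<comment> \<open>A single majorant for all positions of \<open>l\<close>: the first summand comes
    from contracting the triangle \<open>s n\<close>, \<open>s (Suc n)\<close>, \<open>l\<close>,
    the second covers the degenerate case \<open>l = s (Suc n)\<close>, where \<open>T l\<close> is
    the next orbit point.\<close>
  let ?\<delta> = "\<lambda>n. \<alpha> * (p 0 * \<alpha> ^ n + d (s (Suc n)) l + d (s n) l) + p 0 * \<alpha> ^ Suc n"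
  have le: "d (s (Suc n)) (T l) \<le> ?\<delta> n" for n
  proof -
    have pos: "0 \<le> \<alpha> * (p 0 * \<alpha> ^ n + d (s (Suc n)) l + d (s n) l)"
      using \<alpha> p0 nonneg sX l by (intro mult_nonneg_nonneg add_nonneg_nonneg) auto
    have pos': "0 \<le> p 0 * \<alpha> ^ Suc n" using \<alpha> p0 by simp
    consider "l = s n" | "l = s (Suc n)" | "s n \<noteq> l" "s (Suc n) \<noteq> l" by blast
    then show ?thesis
    proof cases
      case 1
      then have "d (s (Suc n)) (T l) = 0" using zero_iff sX s_Suc by simp
      then show ?thesis using pos pos' by linarith
    next
      case 2
      then have "d (s (Suc n)) (T l) \<le> p 0 * \<alpha> ^ Suc n" using step[of "Suc n"] s_Suc by simp
      then show ?thesis using pos by linarith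
    next
      case 3
      \<comment> \<open>The other two sides of the image triangle are nonnegative and are
        dropped.\<close>
      have "d (s (Suc n)) (T l) \<le> \<alpha> * (d (s n) (s (Suc n)) + d (s (Suc n)) l + d (s n) l)"
        using contr[OF sX sX l ne1 3(2,1)] nonneg[OF sX sX, of "Suc n" "Suc (Suc n)"]
          nonneg[OF sX Tl, of "Suc (Suc n)"] by (simp add: s_Suc)
      also have "\<dots> \<le> \<alpha> * (p 0 * \<alpha> ^ n + d (s (Suc n)) l + d (s n) l)"
        using step[of n] \<alpha> by (intro mult_left_mono) auto
      finally show ?thesis using pos' by linarith
    qed
  qed
  have lim: "(\<lambda>n. d (s n) l) \<longlonglongrightarrow> 0"
    using conv unfolding semimetric_converges_def .
  have pow: "(\<lambda>n. \<alpha> ^ n) \<longlonglongrightarrow> 0"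
    using \<alpha> by (intro LIMSEQ_realpow_zero)
  have \<delta>: "?\<delta> \<longlonglongrightarrow> \<alpha> * (p 0 * 0 + 0 + 0) + p 0 * 0"
    by (intro tendsto_intros lim LIMSEQ_Suc[OF lim] pow LIMSEQ_Suc[OF pow])
  have "(\<lambda>n. d (s (Suc n)) (T l)) \<longlonglongrightarrow> 0"
  proof (rule tendsto_sandwich)
    show "\<forall>\<^sub>F n in sequentially. 0 \<le> d (s (Suc n)) (T l)"
      using nonneg[OF sX Tl] by (intro always_eventually allI)
    show "\<forall>\<^sub>F n in sequentially. d (s (Suc n)) (T l) \<le> ?\<delta> n"
      using le by (intro always_eventually allI)
    show "?\<delta> \<longlonglongrightarrow> 0" using \<delta> by simp
  qed simp
  then have "semimetric_converges d s (T l)"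
    unfolding semimetric_converges_def by (rule LIMSEQ_imp_Suc)
  \<comment> \<open>Both \<open>T l\<close> and \<open>l\<close> are limits of the same
    orbit.\<close>
  then have "T l = l" by (rule limit_unique[OF range Tl l _ conv])
  then show False using no_fix l by blast
qed

end

theorem theorem6p4:
  fixes X :: "'a set" and d :: "'a \<Rightarrow> 'a \<Rightarrow> real"
    and \<Phi> :: "real \<Rightarrow> real \<Rightarrow> real" and T :: "'a \<Rightarrow> 'a"
  assumes "semimetric_space X d"
    and "infinite X \<or> card X \<ge> 3"
    and "semimetric_complete X d"
    and "triangle_function X d \<Phi>"
    and "continuous (at (0, 0) within {0..} \<times> {0..}) (\<lambda>(u, v). \<Phi> u v)"
    and "\<And>k u v. k \<ge> 0 \<Longrightarrow> u \<ge> 0 \<Longrightarrow> v \<ge> 0 \<Longrightarrow> \<Phi> (k * u) (k * v) = k * \<Phi> u v"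
    and "\<And>a. 0 \<le> a \<Longrightarrow> a < 1 \<Longrightarrow> \<exists>C>0. \<forall>p\<ge>1. nested_powers \<Phi> a 0 p \<le> C"
    and "T \<in> X \<rightarrow> X"
    and "\<not> (\<exists>x\<in>X. T (T x) = x \<and> T x \<noteq> x)"
    and "contracts_triangle_perimeters X d T"
  shows "(\<exists>x\<in>X. T x = x) \<and> finite {x \<in> X. T x = x} \<and> card {x \<in> X. T x = x} \<le> 2"
proof -
  interpret homogeneous_semimetric X d \<Phi>
    using assms(1,4,6) by unfold_locales
  obtain \<alpha> where \<alpha>: "0 \<le> \<alpha> \<and> \<alpha> < 1 \<and>
      (\<forall>x\<in>X. \<forall>y\<in>X. \<forall>z\<in>X. x \<noteq> y \<and> y \<noteq> z \<and> x \<noteq> z \<longrightarrow>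
        d (T x) (T y) + d (T y) (T z) + d (T x) (T z) \<le> \<alpha> * (d x y + d y z + d x z))"
    using assms(10) unfolding contracts_triangle_perimeters_def ..
  then have contr: "d (T x) (T y) + d (T y) (T z) + d (T x) (T z) \<le> \<alpha> * (d x y + d y z + d x z)"
    if "x \<in> X" "y \<in> X" "z \<in> X" "x \<noteq> y" "y \<noteq> z" "x \<noteq> z" for x y z
    using that by blast
  \<comment> \<open>The bound on nested expressions is taken at the contraction constant, which is
    the ratio of the geometric decay along orbits.\<close>
  obtain C where "\<forall>m\<ge>1. nested_powers \<Phi> \<alpha> 0 m \<le> C"
    using assms(7)[of \<alpha>] \<alpha> by auto
  then have "\<exists>x\<in>X. T x = x"
    using \<alpha> by (intro fixed_point_exists[OF assms(3) _ assms(8,9) _ _ contr]) simp_all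
  moreover have "finite {x \<in> X. T x = x} \<and> card {x \<in> X. T x = x} \<le> 2"
    using \<alpha> by (intro fixed_points_le_two[OF _ contr]) simp_all
  ultimately show ?thesis ..
qed

end
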